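(* Let $0<|q|<1$ and let $\tau(n)=(-1)^nq^{\binom n2}$. For integers $n$ define $$G(n)=\sum_{k=-\infty}^{\infty}\tau(k)^3(1-q^k)q^{(1+n)k},\qquad H(n)=\sum_{k=-\infty}^{\infty}\tau(k)^3q^{(3+n)k}.$$ Then the following two pairs of sequences (indexed by integers $n\ge 0$) are Bailey pairs relative to $a=1$: $$\alpha_n(1,q)=\tau(n)(1-q^n)G(n),\qquad \beta_n(1,q)=(q;q)_\infty\frac{(q^n-1)\,\tau(n)^2}{(q;q)_{2n}},$$ and $$\alpha^{(1)}_n(1,q)=\tau(n)(1-q^{2n})H(n),\qquad \beta^{(1)}_n(1,q)=(q;q)_\infty\frac{\tau(n)^2q^{-n}}{(q;q)_{2n-1}}.$$
   Context: $q$ is a complex number with $0<|q|<1$; $(x;q)_\infty=\prod_{n\ge0}(1-xq^n)$ and $(x;q)_n=(x;q)_\infty/(xq^n;q)_\infty$ for all integers $n$ (so that $1/(q;q)_{-1}=0$). A Bailey pair relative to $a$ is a pair of sequences $(\alpha_n(a,q))_{n\ge0}$, $(\beta_n(a,q))_{n\ge0}$ such that for all $n\ge0$ $$\beta_n(a,q)=\sum_{k=0}^n\frac{\alpha_k(a,q)}{(q;q)_{n-k}(aq;q)_{n+k}}.$$ The binomial $\binom n2=n(n-1)/2$ is used for all integers $n$. *)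

theory Defs
  imports "HOL-Analysis.Analysis"
begin

definition qpoch_inf :: "complex \<Rightarrow> complex \<Rightarrow> complex" where
  "qpoch_inf x q = (\<Prod>n. 1 - x * q ^ n)"

(* When the denominator vanishes, the quotient is 0 by the convention x / 0 = 0, and hence
   so is its reciprocal. In particular 1 / qpoch q q (-1) = 0, the usual convention for
   1/(q;q)_{-1}. *)
definition qpoch :: "complex \<Rightarrow> complex \<Rightarrow> int \<Rightarrow> complex" where
  "qpoch x q n = qpoch_inf x q / qpoch_inf (x * q powi n) q"

definition bailey_pair ::
  "complex \<Rightarrow> complex \<Rightarrow> (nat \<Rightarrow> complex) \<Rightarrow> (nat \<Rightarrow> complex) \<Rightarrow> bool" where
  "bailey_pair a q \<alpha> \<beta> \<longleftrightarrow>
     (\<forall>n. \<beta> n = (\<Sum>k=0..n. \<alpha> k / (qpoch q q (int n - int k) * qpoch (a * q) q (int n + int k))))"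

(* The integer division is exact, since k * (k - 1) is even. *)
definition tau :: "complex \<Rightarrow> int \<Rightarrow> complex" where
  "tau q k = (-1) powi k * q powi (k * (k - 1) div 2)"

(* For 0 < |q| < 1 both bilateral series converge absolutely, because the exponent of q
   grows like 3 k^2 / 2 in both directions. *)
definition G :: "complex \<Rightarrow> int \<Rightarrow> complex" where
  "G q n = (\<Sum>\<^sub>\<infinity>k\<in>(UNIV :: int set). tau q k ^ 3 * (1 - q powi k) * q powi ((1 + n) * k))"

definition H :: "complex \<Rightarrow> int \<Rightarrow> complex" where
  "H q n = (\<Sum>\<^sub>\<infinity>k\<in>(UNIV :: int set). tau q k ^ 3 * q powi ((3 + n) * k))"

end

theory Submission
  imports Defs
begin

text \<open>
  Write \<open>\<alpha> k = tau k * (1 - q powi (s * k)) * (\<Sum>j. c j * q powi (k * j))\<close> with \<open>s = 1\<close> for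
  \<open>G\<close> and \<open>s = 2\<close> for \<open>H\<close>. As
  \<open>\<alpha>\<close> extends to an even function on the integers, the sum defining \<open>\<beta> n\<close> may be taken over
  \<open>- n \<le> k \<le> n\<close>. For fixed \<open>j\<close> the sum over \<open>k\<close> is a difference of two instances of the \<open>q\<close>-binomial
  theorem, and vanishes unless \<open>\<bar>j\<bar>\<close> is about \<open>n\<close> or larger. By a symmetry in \<open>j\<close> the two remaining
  tails agree, and each is Sylvester's series for \<open>(a; q)\<^sub>\<infinity>\<close> at \<open>a = q ^ (2 * n)\<close> or
  \<open>a = q ^ (2 * n - 1)\<close>. Sylvester's series follows from its functional equation
  \<open>F a = (1 - a) * F (a * q)\<close> and its continuity at \<open>a = 0\<close>.
\<close>

section \<open>Finite and infinite \<open>q\<close>-Pochhammer symbols\<close>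

text \<open>A division-free version of \<open>qpoch\<close> for natural indices. It keeps its
  meaning at \<open>x = q powi (j - int n)\<close>, where the quotient of infinite products can
  degenerate to \<open>0 / 0\<close>.\<close>

definition qpoch_fin :: "complex \<Rightarrow> complex \<Rightarrow> nat \<Rightarrow> complex" where
  "qpoch_fin x q n = (\<Prod>i<n. 1 - x * q ^ i)"

lemma qpoch_fin_0 [simp]: "qpoch_fin x q 0 = 1"
  by (simp add: qpoch_fin_def)

lemma qpoch_fin_Suc: "qpoch_fin x q (Suc n) = qpoch_fin x q n * (1 - x * q ^ n)"
  by (simp add: qpoch_fin_def)

lemma qpoch_fin_add: "qpoch_fin x q (m + n) = qpoch_fin x q m * qpoch_fin (x * q ^ m) q n"
  by (induction n) (simp_all add: qpoch_fin_Suc power_add mult_ac)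

lemma qpoch_fin_Suc_left: "qpoch_fin x q (Suc n) = (1 - x) * qpoch_fin (x * q) q n"
  using qpoch_fin_add[of x q 1 n] by (simp add: qpoch_fin_def)

lemma qpoch_fin_eq_0: "i < n \<Longrightarrow> x * q ^ i = 1 \<Longrightarrow> qpoch_fin x q n = 0"
  by (auto simp: qpoch_fin_def intro!: prod_zero)

lemma has_sum_sum:
  fixes f :: "'i \<Rightarrow> 'a \<Rightarrow> 'b :: topological_comm_monoid_add"
  assumes "\<And>i. i \<in> I \<Longrightarrow> (f i has_sum S i) A"
  shows "((\<lambda>x. \<Sum>i\<in>I. f i x) has_sum (\<Sum>i\<in>I. S i)) A"
  using assms by (induction I rule: infinite_finite_induct) (auto intro: has_sum_add)

locale nome =
  fixes q :: complex
  assumes q_pos: "0 < norm q" and q_less_1: "norm q < 1"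
begin

lemma q_nonzero [simp]: "q \<noteq> 0"
  using q_pos by auto

lemmas powi_add = power_int_add[OF disjI1[OF q_nonzero]]

lemma norm_q_power_less_1: "norm (q ^ Suc n) < 1"
  using q_less_1 q_pos by (metis norm_power power_Suc_less_one)

lemma q_power_Suc_neq_1 [simp]: "q * q ^ n \<noteq> 1"
  using norm_q_power_less_1[of n] by (metis less_irrefl norm_one power_Suc)

lemma qfac_nonzero [simp]: "qpoch_fin q q n \<noteq> 0"
  by (simp add: qpoch_fin_def)

lemma convergent_qpoch: "convergent_prod (\<lambda>n. 1 - x * q ^ n)"
proof -
  have "summable (\<lambda>i. norm x * norm q ^ i)"
    using q_less_1 by (intro summable_mult summable_geometric) auto
  then have "abs_convergent_prod (\<lambda>n. 1 - x * q ^ n)"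
    by (intro summable_imp_abs_convergent_prod) (simp add: norm_mult norm_power)
  then show ?thesis
    by (rule abs_convergent_prod_imp_convergent_prod)
qed

lemma qpoch_fin_tendsto: "(\<lambda>n. qpoch_fin x q n) \<longlonglongrightarrow> qpoch_inf x q"
  using convergent_prod_LIMSEQ[OF convergent_qpoch[of x]]
  unfolding qpoch_fin_def qpoch_inf_def
  by (subst filterlim_sequentially_Suc[symmetric]) (simp add: lessThan_Suc_atMost)

lemma qpoch_inf_split: "qpoch_inf x q = qpoch_fin x q n * qpoch_inf (x * q ^ n) q"
proof -
  have "(\<lambda>k. qpoch_fin x q (k + n)) \<longlonglongrightarrow> qpoch_inf x q"
    using qpoch_fin_tendsto by (rule LIMSEQ_ignore_initial_segment)
  moreover have "(\<lambda>k. qpoch_fin x q (k + n)) \<longlonglongrightarrow> qpoch_fin x q n * qpoch_inf (x * q ^ n) q"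
    unfolding add.commute[of _ n] qpoch_fin_add
    by (intro tendsto_intros qpoch_fin_tendsto)
  ultimately show ?thesis
    by (rule LIMSEQ_unique)
qed

text \<open>A convergent infinite product vanishes only if one of its factors does.\<close>

lemma qpoch_inf_nonzero: "qpoch_inf (q ^ Suc n) q \<noteq> 0"
  unfolding qpoch_inf_def
proof (rule prodinf_nonzero[OF convergent_qpoch])
  fix i
  show "1 - q ^ Suc n * q ^ i \<noteq> 0"
    using q_power_Suc_neq_1[of "n + i"] by (simp add: power_add mult.assoc)
qed

lemma qpoch_eq_fin: "qpoch q q (int n) = qpoch_fin q q n"
  using qpoch_inf_split[of q n] qpoch_inf_nonzero[of n] by (simp add: qpoch_def)

text \<open>The denominator is \<open>qpoch_inf 1 q\<close>, which vanishes through its first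
  factor, so the convention \<open>x / 0 = 0\<close> decides. This settles the second pair at
  \<open>n = 0\<close>.\<close>

lemma qpoch_minus_1: "qpoch q q (-1) = 0"
  using qpoch_inf_split[of 1 1] by (simp add: qpoch_def power_int_minus qpoch_fin_def)

section \<open>Algebra of \<open>tau\<close> and convergence of the bilateral series\<close>

text \<open>The binomial of \<open>a + b\<close> over 2 exceeds the sum of those of \<open>a\<close>
  and \<open>b\<close> by \<open>a * b\<close>.\<close>

lemma tau_add: "tau q (a + b) = tau q a * tau q b * q powi (a * b)"
proof -
  have "even (a * (a - 1))" "even (b * (b - 1))" by auto
  then obtain x y where xy: "a * (a - 1) = 2 * x" "b * (b - 1) = 2 * y"
    by (meson evenE)
  have "(a + b) * (a + b - 1) = a * (a - 1) + b * (b - 1) + 2 * (a * b)"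
    by (simp add: algebra_simps)
  also have "\<dots> = 2 * (x + y + a * b)"
    by (simp add: xy)
  finally have "(a + b) * (a + b - 1) div 2 = a * (a - 1) div 2 + b * (b - 1) div 2 + a * b"
    by (simp add: xy)
  then show ?thesis
    by (simp add: tau_def powi_add power_int_add)
qed

lemma tau_0 [simp]: "tau q 0 = 1" and tau_1 [simp]: "tau q 1 = -1"
  by (simp_all add: tau_def)

lemma tau_nonzero [simp]: "tau q k \<noteq> 0"
  by (simp add: tau_def)

lemma tau_Suc: "tau q (k + 1) = - tau q k * q powi k"
  by (simp add: tau_add)

lemma tau_uminus: "tau q (- k) = tau q k * q powi k"
proof -
  have "(- k) * (- k - 1) = k * (k - 1) + 2 * k"
    by (simp add: algebra_simps)
  then have "(- k) * (- k - 1) div 2 = k * (k - 1) div 2 + k"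
    by (simp only:)
  then show ?thesis
    by (simp add: tau_def powi_add power_int_minus flip: power_int_inverse)
qed

lemma tau_power2: "tau q k ^ 2 * q powi k = q powi (k * k)"
proof -
  \<comment> \<open>Expanding \<open>tau q 0\<close> along \<open>- k + k\<close> yields the square
    without unfolding the exponent.\<close>
  have "1 = tau q (- k + k)" by simp
  also have "\<dots> = tau q k ^ 2 * q powi k * q powi (- (k * k))"
    by (simp only: tau_add tau_uminus) (simp add: power2_eq_square)
  finally show ?thesis
    by (simp add: power_int_minus field_simps)
qed

text \<open>Consecutive terms have ratio \<open>- (q powi (3 * int n + m))\<close>. Once
  \<open>n\<close> exceeds \<open>\<bar>m\<bar>\<close> the exponent is at least 1, so the ratio has
  norm at most \<open>norm q\<close>.\<close>

lemma summable_tau_cubed_nat: "summable (\<lambda>n. norm (tau q (int n) ^ 3 * q powi (m * int n)))"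
proof (rule summable_ratio_test[where c = "norm q" and N = "nat \<bar>m\<bar> + 1"])
  fix n assume n: "nat \<bar>m\<bar> + 1 \<le> n"
  have *: "tau q (int (Suc n)) ^ 3 * q powi (m * int (Suc n)) =
        tau q (int n) ^ 3 * q powi (m * int n) * (- (q ^ nat (3 * int n + m)))"
  proof -
    have "q ^ nat (3 * int n + m) = q powi (3 * int n + m)"
      using n by (simp add: power_int_nonneg_exp)
    also have "\<dots> = (q powi int n) ^ 3 * q powi m"
      by (simp add: powi_add power_int_mult mult.commute[of 3] del: power_int_of_nat)
    finally show ?thesis
      by (simp add: tau_Suc power_mult_distrib power3_eq_cube ring_distribs powi_add add.commute[of 1]
          del: power_int_of_nat)
  qed
  have "norm (q ^ nat (3 * int n + m)) \<le> norm q ^ 1"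
    unfolding norm_power using n q_less_1 by (intro power_decreasing) auto
  then have "norm (tau q (int n) ^ 3 * q powi (m * int n)) * norm (q ^ nat (3 * int n + m))
      \<le> norm (tau q (int n) ^ 3 * q powi (m * int n)) * norm q"
    by (intro mult_left_mono) auto
  then show "norm (norm (tau q (int (Suc n)) ^ 3 * q powi (m * int (Suc n))))
      \<le> norm q * norm (norm (tau q (int n) ^ 3 * q powi (m * int n)))"
    unfolding * by (simp add: norm_mult mult_ac del: of_nat_Suc)
qed (use q_less_1 in auto)

text \<open>The reflection of \<open>j\<close> to \<open>- j\<close> turns the parameter
  \<open>m\<close> into \<open>3 - m\<close>, so the negative half is again a one-sided
  series.\<close>

lemma summable_tau_cubed: "(\<lambda>j. tau q j ^ 3 * q powi (m * j)) summable_on (UNIV :: int set)"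
proof -
  let ?f = "\<lambda>m j. tau q j ^ 3 * q powi (m * j)"
  have *: "?f m summable_on range int" for m
    using norm_summable_imp_summable_on[OF summable_tau_cubed_nat[of m]]
    by (subst summable_on_reindex) (simp_all add: o_def)
  have "?f m (- j) = ?f (3 - m) j" for j
    by (simp add: tau_uminus power_mult_distrib ring_distribs powi_add power_int_diff
        power_int_minus power_int_power' mult.commute divide_inverse)
  then have "?f m summable_on uminus ` range int"
    using *[of "3 - m"] by (subst summable_on_reindex) (simp_all only: o_def inj_on_def, auto)
  then have "?f m summable_on range int \<union> uminus ` range int"
    using * by (intro summable_on_union)
  moreover have "range int \<union> uminus ` range int = UNIV"
    by (auto intro: int_cases2)
  ultimately show ?thesis by simp
qed

section \<open>Sylvester's series for the infinite product\<close>

text \<open>Here \<open>tau q r ^ 3 * q ^ r\<close> is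
  \<open>(-1) ^ r * q ^ (r * (3 * r - 1) div 2)\<close>, with a pentagonal exponent. At
  \<open>a = q\<close> the series is that of Euler's pentagonal number theorem.\<close>

definition sylvester_term :: "complex \<Rightarrow> nat \<Rightarrow> complex" where
  "sylvester_term a r =
     tau q (int r) ^ 3 * (a * q) ^ r * (1 - a * q ^ (2 * r)) * qpoch_fin a q r / qpoch_fin q q r"

text \<open>A bound uniform in \<open>norm a \<le> 1\<close>: the leading 2 dominates
  \<open>1 - a * q ^ (2 * r)\<close>, and the power of 2 dominates
  \<open>qpoch_fin a q r\<close>.\<close>

definition sylvester_majorant :: "nat \<Rightarrow> real" where
  "sylvester_majorant r = 2 * norm (tau q (int r) ^ 3 * (2 * q) ^ r / qpoch_fin q q r)"

text \<open>The ratio of consecutive terms tends to 0, since the cube of \<open>tau\<close>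
  contributes \<open>(q ^ r) ^ 3\<close> against a bounded factor.\<close>

lemma summable_sylvester_majorant: "summable sylvester_majorant"
proof -
  define g where "g r = tau q (int r) ^ 3 * (2 * q) ^ r / qpoch_fin q q r" for r
  define h where "h r = - ((q ^ r) ^ 3) * (2 * q) / (1 - q * q ^ r)" for r
  have g_Suc: "g (Suc r) = g r * h r" for r
    by (simp add: g_def h_def qpoch_fin_Suc tau_Suc add.commute[of 1] power_mult_distrib)
  have "(\<lambda>r. q ^ r) \<longlonglongrightarrow> 0"
    using q_less_1 by (rule LIMSEQ_power_zero)
  then have "h \<longlonglongrightarrow> - (0 ^ 3) * (2 * q) / (1 - q * 0)"
    unfolding h_def by (intro tendsto_intros) (use q_less_1 in auto)
  then have "eventually (\<lambda>r. dist (h r) 0 < 1 / 2) sequentially"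
    by (intro tendstoD) auto
  then obtain N where N: "\<And>r. r \<ge> N \<Longrightarrow> norm (h r) < 1 / 2"
    by (auto simp: eventually_sequentially)
  have "summable (\<lambda>r. norm (g r))"
  proof (rule summable_ratio_test[where c = "1 / 2" and N = N])
    fix r assume "N \<le> r"
    then have "norm (g r) * norm (h r) \<le> norm (g r) * (1 / 2)"
      using N[of r] by (intro mult_left_mono) auto
    then show "norm (norm (g (Suc r))) \<le> 1 / 2 * norm (norm (g r))"
      by (simp add: g_Suc norm_mult)
  qed auto
  then show ?thesis
    unfolding sylvester_majorant_def[abs_def] g_def by (rule summable_mult)
qed

lemma norm_qpoch_fin_le:
  assumes "norm a \<le> 1"
  shows "norm (qpoch_fin a q n) \<le> 2 ^ n"
proof (induction n)
  case (Suc n)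
  have "norm (a * q ^ n) \<le> 1 * 1"
    unfolding norm_mult norm_power using assms q_less_1
    by (intro mult_mono power_le_one) auto
  then have "norm (1 - a * q ^ n) \<le> 2"
    using norm_triangle_ineq4[of 1 "a * q ^ n"] by simp
  then have "norm (qpoch_fin a q n) * norm (1 - a * q ^ n) \<le> 2 ^ n * 2"
    using Suc by (intro mult_mono) auto
  then show ?case
    by (simp add: qpoch_fin_Suc norm_mult mult.commute)
qed simp

text \<open>The factor \<open>x\<close> is left free so that the bound serves both the series, with
  \<open>x = 1 - a * q ^ (2 * r)\<close>, and its telescoping certificate, with
  \<open>x = 1 - q ^ r\<close>.\<close>

lemma norm_sylvester_le:
  assumes "norm a \<le> 1" "norm x \<le> 2"
  shows "norm (tau q (int r) ^ 3 * (a * q) ^ r * x * qpoch_fin a q r / qpoch_fin q q r)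
    \<le> sylvester_majorant r"
proof -
  have "norm (a ^ r) \<le> 1"
    unfolding norm_power using assms by (intro power_le_one) auto
  then have "norm (a ^ r) * norm x * norm (qpoch_fin a q r) \<le> 1 * 2 * 2 ^ r"
    using assms norm_qpoch_fin_le by (intro mult_mono) auto
  then have "norm (tau q (int r) ^ 3 * q ^ r / qpoch_fin q q r) *
      (norm (a ^ r) * norm x * norm (qpoch_fin a q r))
      \<le> norm (tau q (int r) ^ 3 * q ^ r / qpoch_fin q q r) * (1 * 2 * 2 ^ r)"
    by (rule mult_left_mono) auto
  then show ?thesis
    by (simp add: sylvester_majorant_def norm_mult norm_divide norm_power power_mult_distrib mult_ac)
qed

lemma norm_sylvester_term_le:
  assumes "norm a \<le> 1"
  shows "norm (sylvester_term a r) \<le> sylvester_majorant r"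
  unfolding sylvester_term_def
proof (rule norm_sylvester_le[OF assms])
  have "norm (a * q ^ (2 * r)) \<le> 1 * 1"
    unfolding norm_mult norm_power using assms q_less_1
    by (intro mult_mono power_le_one) auto
  then show "norm (1 - a * q ^ (2 * r)) \<le> 2"
    using norm_triangle_ineq4[of 1 "a * q ^ (2 * r)"] by simp
qed

lemma summable_norm_sylvester_term:
  "norm a \<le> 1 \<Longrightarrow> summable (\<lambda>r. norm (sylvester_term a r))"
  by (rule summable_comparison_test'[OF summable_sylvester_majorant, of 0])
    (simp add: norm_sylvester_term_le)

lemma suminf_sylvester_shift:
  assumes a: "norm a \<le> 1"
  shows "suminf (sylvester_term a) = (1 - a) * suminf (sylvester_term (a * q))"
proof -
  \<comment> \<open>A telescoping certificate: the term of the series with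
    \<open>1 - a * q ^ (2 * r)\<close> replaced by \<open>1 - q ^ r\<close>. It vanishes at
    \<open>r = 0\<close> and tends to 0, so its differences sum to 0.\<close>
  define u where
    "u r = tau q (int r) ^ 3 * (a * q) ^ r * (1 - q ^ r) * qpoch_fin a q r / qpoch_fin q q r" for r
  have aq: "norm (a * q) \<le> 1"
    using a q_less_1 by (simp add: norm_mult mult_le_one)
  have "norm (u r) \<le> sylvester_majorant r" for r
    unfolding u_def
  proof (rule norm_sylvester_le[OF a])
    have "norm (q ^ r) \<le> 1"
      unfolding norm_power using q_less_1 by (intro power_le_one) auto
    then show "norm (1 - q ^ r) \<le> 2"
      using norm_triangle_ineq4[of 1 "q ^ r"] by simp
  qed
  then have "u \<longlonglongrightarrow> 0"
    using summable_LIMSEQ_zero[OF summable_sylvester_majorant]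
    by (intro Lim_null_comparison[of u sylvester_majorant]) auto
  then have "(\<lambda>r. u r - u (Suc r)) sums (u 0 - 0)"
    by (rule telescope_sums')
  moreover have "u r - u (Suc r) = sylvester_term a r - (1 - a) * sylvester_term (a * q) r" for r
  proof -
    define Q where "Q = q ^ r"
    define A where "A = a ^ r"
    \<comment> \<open>This brings the symbol with base \<open>a * q\<close> back to base
      \<open>a\<close>, so that all terms share a factor and only a polynomial identity in
      \<open>a\<close>, \<open>q\<close> and \<open>Q\<close> remains.\<close>
    have a_Suc: "qpoch_fin a q r * (1 - a * Q) = (1 - a) * qpoch_fin (a * q) q r"
      using qpoch_fin_Suc[of a q r] qpoch_fin_Suc_left[of a q r] by (simp add: Q_def)
    have "u (Suc r) = - (tau q (int r) ^ 3) * Q ^ 3 * (A * a) * (Q * q)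
        * (qpoch_fin a q r * (1 - a * Q)) / qpoch_fin q q r"
      using q_power_Suc_neq_1[of r]
      by (simp add: u_def Q_def A_def qpoch_fin_Suc tau_Suc add.commute[of 1] power_mult_distrib
          divide_simps del: q_power_Suc_neq_1)
    moreover have "u r = tau q (int r) ^ 3 * A * Q * (1 - Q) * qpoch_fin a q r / qpoch_fin q q r"
      by (simp add: u_def Q_def A_def power_mult_distrib)
    moreover have "sylvester_term a r =
        tau q (int r) ^ 3 * A * Q * (1 - a * Q\<^sup>2) * qpoch_fin a q r / qpoch_fin q q r"
      by (simp add: sylvester_term_def Q_def A_def power_mult_distrib power_mult mult.commute[of 2])
    moreover have "(1 - a) * sylvester_term (a * q) r = tau q (int r) ^ 3 * A * Q\<^sup>2 * (1 - a * q * Q\<^sup>2)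
        * (qpoch_fin a q r * (1 - a * Q)) / qpoch_fin q q r"
      unfolding a_Suc
      by (simp add: sylvester_term_def Q_def A_def power_mult_distrib power_mult mult.commute[of 2]
          power2_eq_square)
    ultimately show ?thesis
      by (simp only:) (simp add: divide_simps, simp add: algebra_simps power2_eq_square power3_eq_cube)
  qed
  ultimately have "(\<lambda>r. sylvester_term a r - (1 - a) * sylvester_term (a * q) r) sums 0"
    by (simp add: u_def)
  moreover have "(\<lambda>r. sylvester_term a r - (1 - a) * sylvester_term (a * q) r) sums
      (suminf (sylvester_term a) - (1 - a) * suminf (sylvester_term (a * q)))"
    using summable_norm_cancel[OF summable_norm_sylvester_term] a aq
    by (intro sums_diff sums_mult summable_sums) auto
  ultimately show ?thesis
    using sums_unique2 by fastforce
qed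

text \<open>The partial sums are polynomials in \<open>a\<close>, and the majorant makes their
  convergence uniform on the closed disc.\<close>

lemma continuous_on_suminf_sylvester:
  "continuous_on (cball 0 1) (\<lambda>a. suminf (sylvester_term a))"
proof (rule uniform_limit_theorem[OF _ Weierstrass_m_test])
  show "\<forall>\<^sub>F n in sequentially. continuous_on (cball 0 1) (\<lambda>a. \<Sum>r<n. sylvester_term a r)"
    unfolding sylvester_term_def qpoch_fin_def
    by (intro always_eventually allI continuous_intros) (use qfac_nonzero in \<open>auto simp: qpoch_fin_def\<close>)
qed (use norm_sylvester_term_le summable_sylvester_majorant in auto)

text \<open>
  The limiting case of the very-well-poised sum in which all three free numerator parameters
  tend to infinity.
\<close>

theorem sylvester_sums:
  assumes a: "norm a \<le> 1"
  shows "sylvester_term a sums qpoch_inf a q"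
proof -
  have aq: "norm (a * q ^ n) \<le> 1" for n
    using a q_less_1 by (simp add: norm_mult norm_power mult_le_one power_le_one)
  have iter: "suminf (sylvester_term a) = qpoch_fin a q n * suminf (sylvester_term (a * q ^ n))" for n
  proof (induction n)
    case (Suc n)
    then show ?case
      using suminf_sylvester_shift[OF aq[of n]] by (simp add: qpoch_fin_Suc mult_ac)
  qed simp
  have "(\<lambda>n. a * q ^ n) \<longlonglongrightarrow> a * 0"
    using q_less_1 by (intro tendsto_intros LIMSEQ_power_zero)
  then have "(\<lambda>n. suminf (sylvester_term (a * q ^ n))) \<longlonglongrightarrow> suminf (sylvester_term 0)"
    using aq by (intro continuous_on_tendsto_compose[OF continuous_on_suminf_sylvester]) auto
  moreover have "suminf (sylvester_term 0) = 1"
  proof -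
    have "sylvester_term 0 r = (if r = 0 then 1 else 0)" for r
      by (simp add: sylvester_term_def power_0_left)
    then show ?thesis
      using sums_single[of 0 "\<lambda>_. 1 :: complex"] by (simp add: sums_iff cong: suminf_cong)
  qed
  ultimately have "(\<lambda>n. qpoch_fin a q n * suminf (sylvester_term (a * q ^ n))) \<longlonglongrightarrow> qpoch_inf a q * 1"
    using qpoch_fin_tendsto by (intro tendsto_mult) auto
  then have "suminf (sylvester_term a) = qpoch_inf a q"
    by (simp add: iter[symmetric] LIMSEQ_const_iff)
  then show ?thesis
    using summable_norm_cancel[OF summable_norm_sylvester_term[OF a]] by (simp add: sums_iff)
qed

text \<open>Sylvester's series at \<open>a = q ^ (m + 1)\<close>, multiplied by
  \<open>qpoch_fin q q m\<close>. Splitting \<open>qpoch_fin q q (m + r)\<close> in two ways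
  replaces its denominators by a finite product, the shape in which the tails of the Bailey sum
  appear.\<close>

corollary sylvester_has_sum:
  "((\<lambda>r. tau q (int r) ^ 3 * q ^ ((m + 2) * r) * (1 - q ^ (m + 1 + 2 * r)) * qpoch_fin (q ^ Suc r) q m)
     has_sum qpoch_inf q q) UNIV"
proof -
  have le: "norm (q ^ (m + 1)) \<le> 1"
    using q_less_1 by (simp only: norm_power power_le_one norm_ge_zero less_imp_le)
  have "qpoch_fin q q r * qpoch_fin (q ^ Suc r) q m = qpoch_fin q q m * qpoch_fin (q ^ Suc m) q r" for r
    using qpoch_fin_add[of q q r m] qpoch_fin_add[of q q m r] by (simp add: add.commute)
  then have "qpoch_fin (q ^ Suc r) q m = qpoch_fin q q m * qpoch_fin (q ^ Suc m) q r / qpoch_fin q q r" for r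
    by (simp add: field_simps)
  then have "tau q (int r) ^ 3 * q ^ ((m + 2) * r) * (1 - q ^ (m + 1 + 2 * r)) * qpoch_fin (q ^ Suc r) q m
      = qpoch_fin q q m * sylvester_term (q ^ (m + 1)) r" for r
    by (simp add: sylvester_term_def power_add power_mult power_mult_distrib mult_ac)
  moreover have "(sylvester_term (q ^ (m + 1)) has_sum qpoch_inf (q ^ (m + 1)) q) UNIV"
    using norm_summable_imp_has_sum[OF summable_norm_sylvester_term sylvester_sums] le by blast
  then have "((\<lambda>r. qpoch_fin q q m * sylvester_term (q ^ (m + 1)) r) has_sum
      qpoch_fin q q m * qpoch_inf (q ^ (m + 1)) q) UNIV"
    by (rule has_sum_cmult_right)
  ultimately show ?thesis
    using qpoch_inf_split[of q m] by simp
qed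

section \<open>The \<open>q\<close>-binomial theorem and the kernel of the Bailey sum\<close>

text \<open>The induction rests on the \<open>q\<close>-Pascal split of \<open>1 - q ^ Suc N\<close>
  as \<open>(1 - q ^ (Suc N - i)) + q ^ (Suc N - i) * (1 - q ^ i)\<close>: each part cancels the
  last factor of one denominator and leaves a term of the sum for \<open>N\<close>.\<close>

theorem q_binomial:
  "(\<Sum>i\<le>N. tau q (int i) * x ^ i / (qpoch_fin q q i * qpoch_fin q q (N - i)))
     = qpoch_fin x q N / qpoch_fin q q N"
proof (induction N)
  case (Suc N)
  define t where "t N i = tau q (int i) * x ^ i / (qpoch_fin q q i * qpoch_fin q q (N - i))" for N i
  have 1: "(1 - q ^ (Suc N - i)) * t (Suc N) i = t N i" if "i \<le> N" for i
  proof -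
    have "Suc N - i = Suc (N - i)" using that by simp
    then show ?thesis
      by (simp add: t_def qpoch_fin_Suc divide_simps)
  qed
  have 2: "q ^ (Suc N - Suc i) * (1 - q ^ Suc i) * t (Suc N) (Suc i) = - x * q ^ N * t N i"
    if "i \<le> N" for i
  proof -
    have "q ^ (N - i) * q ^ i = q ^ N"
      using that by (simp flip: power_add)
    then show ?thesis
      by (simp add: t_def qpoch_fin_Suc tau_Suc add.commute[of 1] divide_simps mult_ac)
  qed
  have "(1 - q ^ Suc N) * (\<Sum>i\<le>Suc N. t (Suc N) i)
      = (\<Sum>i\<le>Suc N. (1 - q ^ (Suc N - i)) * t (Suc N) i + q ^ (Suc N - i) * (1 - q ^ i) * t (Suc N) i)"
    unfolding sum_distrib_left
  proof (rule sum.cong)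
    fix i assume "i \<in> {..Suc N}"
    then have "q ^ Suc N = q ^ (Suc N - i) * q ^ i"
      by (simp flip: power_add)
    then show "(1 - q ^ Suc N) * t (Suc N) i =
        (1 - q ^ (Suc N - i)) * t (Suc N) i + q ^ (Suc N - i) * (1 - q ^ i) * t (Suc N) i"
      by (simp only:) (simp add: algebra_simps)
  qed simp
  also have "\<dots> = (\<Sum>i\<le>Suc N. (1 - q ^ (Suc N - i)) * t (Suc N) i)
      + (\<Sum>i\<le>Suc N. q ^ (Suc N - i) * (1 - q ^ i) * t (Suc N) i)"
    by (rule sum.distrib)
  \<comment> \<open>The top term drops out here, and the bottom one in the next sum, since each
    carries the factor \<open>1 - q ^ 0\<close>.\<close>
  also have "(\<Sum>i\<le>Suc N. (1 - q ^ (Suc N - i)) * t (Suc N) i) = (\<Sum>i\<le>N. t N i)"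
    unfolding sum.atMost_Suc using 1 by simp
  also have "(\<Sum>i\<le>Suc N. q ^ (Suc N - i) * (1 - q ^ i) * t (Suc N) i) = (\<Sum>i\<le>N. - x * q ^ N * t N i)"
    unfolding sum.atMost_Suc_shift using 2 by simp
  also have "(\<Sum>i\<le>N. t N i) + (\<Sum>i\<le>N. - x * q ^ N * t N i) = (1 - x * q ^ N) * (\<Sum>i\<le>N. t N i)"
    by (simp add: sum_distrib_left left_diff_distrib sum_subtractf sum_negf)
  also have "(\<Sum>i\<le>N. t N i) = qpoch_fin x q N / qpoch_fin q q N"
    using Suc.IH by (simp add: t_def)
  finally have "(\<Sum>i\<le>Suc N. t (Suc N) i)
      = (1 - x * q ^ N) * (qpoch_fin x q N / qpoch_fin q q N) / (1 - q ^ Suc N)"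
    by (subst eq_divide_eq) (simp del: sum.atMost_Suc add: mult.commute[of _ "1 - q * q ^ N"])
  then show ?case
    unfolding t_def qpoch_fin_Suc by (simp del: sum.atMost_Suc add: mult.commute)
qed simp

text \<open>
  The coefficient of \<open>c j\<close> in the Bailey sum with \<open>\<alpha> k = tau k * (\<Sum>j. c j * q powi (k * j))\<close>,
  summed over \<open>- n \<le> k \<le> n\<close> and indexed by \<open>i = n + k\<close>.
\<close>

definition bailey_kernel :: "nat \<Rightarrow> int \<Rightarrow> complex" where
  "bailey_kernel n j = (\<Sum>i\<le>2 * n. tau q (int i - int n) * q powi ((int i - int n) * j)
     / (qpoch_fin q q i * qpoch_fin q q (2 * n - i)))"

text \<open>By \<open>tau_add\<close>, shifting the index by \<open>n\<close> only contributes
  powers of \<open>q\<close>, so this is the \<open>q\<close>-binomial theorem at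
  \<open>x = q powi (j - int n)\<close>.\<close>

lemma bailey_kernel_eq:
  "bailey_kernel n j = tau q (- int n) * q powi (- (int n * j)) *
     qpoch_fin (q powi (j - int n)) q (2 * n) / qpoch_fin q q (2 * n)"
proof -
  have "tau q (int i - int n) * q powi ((int i - int n) * j) =
      tau q (- int n) * q powi (- (int n * j)) * (tau q (int i) * (q powi (j - int n)) ^ i)" for i
  proof -
    have "tau q (int i - int n) = tau q (- int n) * tau q (int i) * q powi (- (int n * int i))"
      using tau_add[of "- int n" "int i"] by simp
    moreover have "q powi (- (int n * int i)) * q powi ((int i - int n) * j) =
        q powi (- (int n * j)) * q powi ((j - int n) * int i)"
      unfolding powi_add[symmetric] by (simp add: algebra_simps)
    ultimately show ?thesis
      by (simp add: power_int_power')
  qed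
  then show ?thesis
    unfolding bailey_kernel_def q_binomial[of _ "2 * n", symmetric] times_divide_eq_right[symmetric]
      sum_distrib_left
    by (simp add: mult.assoc)
qed

text \<open>Replacing \<open>k\<close> by \<open>- k\<close>, that is \<open>i\<close> by
  \<open>2 * n - i\<close>, swaps the denominators and turns the exponent \<open>k * j\<close> into
  \<open>k * (1 - j)\<close> by \<open>tau_uminus\<close>.\<close>

lemma bailey_kernel_reflect: "bailey_kernel n (1 - j) = bailey_kernel n j"
  unfolding bailey_kernel_def
proof (rule sum.reindex_bij_witness[where i = "\<lambda>i. 2 * n - i" and j = "\<lambda>i. 2 * n - i"])
  fix i assume "i \<in> {..2 * n}"
  then have i: "i \<le> 2 * n" by simp
  define k where "k = int i - int n"
  have k': "int (2 * n - i) - int n = - k"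
    using i by (simp add: k_def)
  have "tau q (- k) * q powi (- k * j) = tau q k * q powi (k * (1 - j))"
    by (simp add: tau_uminus mult.assoc flip: powi_add) (simp add: algebra_simps)
  then show "tau q (int (2 * n - i) - int n) * q powi ((int (2 * n - i) - int n) * j) /
      (qpoch_fin q q (2 * n - i) * qpoch_fin q q (2 * n - (2 * n - i))) =
      tau q (int i - int n) * q powi ((int i - int n) * (1 - j)) /
      (qpoch_fin q q i * qpoch_fin q q (2 * n - i))"
    using i unfolding k' k_def[symmetric] by (simp add: mult.commute)
qed auto

text \<open>The factor of index \<open>n - j\<close> in the product form is
  \<open>1 - q ^ 0\<close>; the bounds on \<open>j\<close> say that this index lies between
  \<open>0\<close> and \<open>2 * n - 1\<close>. For \<open>n = 0\<close> they are
  contradictory.\<close>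

lemma bailey_kernel_eq_0:
  assumes "1 - int n \<le> j" "j \<le> int n"
  shows "bailey_kernel n j = 0"
proof (cases "n = 0")
  case False
  have "q powi (j - int n) * q ^ nat (int n - j) = q powi (j - int n) * q powi (int n - j)"
    using assms by (simp add: power_int_nonneg_exp)
  also have "\<dots> = 1"
    by (simp flip: powi_add)
  finally have "qpoch_fin (q powi (j - int n)) q (2 * n) = 0"
    using assms False by (intro qpoch_fin_eq_0[of "nat (int n - j)"]) auto
  then show ?thesis
    by (simp add: bailey_kernel_eq)
qed (use assms in simp)

section \<open>Folding the double sum by its symmetries\<close>

text \<open>Both halves contribute equally. The central term belongs to one half only, but it is
  zero and may be added to the other.\<close>

lemma sum_fold_even:
  fixes \<alpha> :: "int \<Rightarrow> complex" and w :: "nat \<Rightarrow> complex"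
  assumes "\<And>k. \<alpha> (- k) = \<alpha> k" and "\<alpha> 0 = 0"
  shows "(\<Sum>i\<le>2 * n. \<alpha> (int i - int n) / (w i * w (2 * n - i)))
    = 2 * (\<Sum>k=0..n. \<alpha> (int k) / (w (n - k) * w (n + k)))" (is "sum ?f _ = 2 * sum ?g _")
proof -
  have "{..2 * n} = {..<n} \<union> {n..2 * n}" by auto
  then have "sum ?f {..2 * n} = sum ?f {..<n} + sum ?f {n..2 * n}"
    by (simp only:) (rule sum.union_disjoint; auto)
  also have "sum ?f {..<n} = sum ?g {1..n}"
  proof (rule sum.reindex_bij_witness[where i = "\<lambda>k. n - k" and j = "\<lambda>k. n - k"])
    fix i assume "i \<in> {..<n}"
    then have "int (n - i) = - (int i - int n)" "n - (n - i) = i" "n + (n - i) = 2 * n - i" by auto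
    then show "?g (n - i) = ?f i"
      using assms(1) by (simp only:)
  qed auto
  also have "sum ?g {1..n} = sum ?g {0..n}"
    using assms(2) by (simp add: sum.atLeast_Suc_atMost)
  also have "sum ?f {n..2 * n} = sum ?g {0..n}"
    by (rule sum.reindex_bij_witness[where i = "\<lambda>k. n + k" and j = "\<lambda>k. k - n"])
      (auto simp: mult.commute intro!: arg_cong2[where f = "(/)"] arg_cong[where f = \<alpha>]
        arg_cong[where f = w])
  finally show ?thesis by simp
qed

text \<open>The reflection in \<open>l\<close> exchanges the tails \<open>{m..}\<close> and
  \<open>{..l - m}\<close>, which are disjoint by \<open>l < 2 * m\<close>; nothing is left between
  them.\<close>

lemma has_sum_symmetric_halves:
  fixes f :: "int \<Rightarrow> complex"
  assumes sum: "((\<lambda>r::nat. f (m + int r)) has_sum S) UNIV"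
    and refl: "\<And>j. f (l - j) = f j"
    and zero: "\<And>j. l - m < j \<Longrightarrow> j < m \<Longrightarrow> f j = 0"
    and disj: "l < 2 * m"
  shows "(f has_sum 2 * S) UNIV"
proof -
  have right: "(f has_sum S) {m..}"
    using sum by (subst has_sum_reindex_bij_witness[where j = "\<lambda>j. nat (j - m)" and i = "\<lambda>r. m + int r"
          and T = UNIV and h = "\<lambda>r. f (m + int r)"]) auto
  then have left: "(f has_sum S) {..l - m}"
    by (subst has_sum_reindex_bij_witness[where j = "\<lambda>j. l - j" and i = "\<lambda>j. l - j"
          and T = "{m..}" and h = f]) (auto simp: refl)
  have "(f has_sum S + S) ({m..} \<union> {..l - m})"
    using disj by (intro has_sum_Un_disjoint right left) auto
  then show ?thesis
    by (subst has_sum_cong_neutral[where T = "{m..} \<union> {..l - m}" and g = f]) (auto intro!: zero)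
qed

text \<open>
  The antisymmetry of \<open>c\<close> makes the summand on the left even in \<open>k\<close> and the double sum invariant under
  \<open>j \<mapsto> 1 - s - j\<close>.
\<close>

theorem bailey_sum:
  fixes c :: "int \<Rightarrow> complex" and s :: int
  assumes c: "\<And>j. c (1 - s - j) = - c j"
    and summable: "\<And>k. (\<lambda>j. c j * q powi (k * j)) summable_on UNIV"
    and s: "0 < s" "s \<le> 2 * int n"
    and S: "((\<lambda>r. c (int n + 1 - s + int r) * (bailey_kernel n (int n + 1 - s + int r)
               - bailey_kernel n (int n + 1 + int r))) has_sum S) UNIV"
  shows "(\<Sum>k=0..n. tau q (int k) * (1 - q powi (s * int k)) * (\<Sum>\<^sub>\<infinity>j. c j * q powi (int k * j))
           / (qpoch_fin q q (n - k) * qpoch_fin q q (n + k))) = S"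
proof -
  define A where "A k = (\<Sum>\<^sub>\<infinity>j. c j * q powi (k * j))" for k
  define \<alpha> where "\<alpha> k = tau q k * (1 - q powi (s * k)) * A k" for k
  have A: "((\<lambda>j. c j * q powi (k * j)) has_sum A k) UNIV" for k
    unfolding A_def using summable by (rule has_sum_infsum)
  have A_uminus: "A (- k) = - (q powi (k * (s - 1))) * A k" for k
  proof -
    have "((\<lambda>j. - (q powi (k * (s - 1))) * (c j * q powi (k * j))) has_sum
        - (q powi (k * (s - 1))) * A k) UNIV"
      by (intro has_sum_cmult_right A)
    also have "?this \<longleftrightarrow> ((\<lambda>j. c j * q powi (- k * j)) has_sum - (q powi (k * (s - 1))) * A k) UNIV"
    proof (rule has_sum_reindex_bij_witness[where i = "\<lambda>j. 1 - s - j" and j = "\<lambda>j. 1 - s - j"])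
      fix j
      have "q powi (k * (s - 1)) * q powi (k * j) = q powi (- k * (1 - s - j))"
        unfolding powi_add[symmetric] by (simp add: algebra_simps)
      then show "c (1 - s - j) * q powi (- k * (1 - s - j)) =
          - (q powi (k * (s - 1))) * (c j * q powi (k * j))"
        by (simp add: c)
    qed auto
    finally show ?thesis
      using A[of "- k"] has_sum_unique by blast
  qed
  \<comment> \<open>The signs from \<open>A_uminus\<close> and from
    \<open>1 - q powi (- s * k)\<close> cancel, and so do the powers of \<open>q\<close> with
    exponents \<open>k\<close>, \<open>- s * k\<close> and \<open>k * (s - 1)\<close>.\<close>
  have even: "\<alpha> (- k) = \<alpha> k" for k
  proof -
    have "q powi (k * s) = q powi (k * (s - 1)) * q powi k"
      by (simp add: algebra_simps flip: powi_add)
    then show ?thesis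
      by (simp add: \<alpha>_def A_uminus tau_uminus power_int_minus mult.commute[of s] field_simps)
  qed
  \<comment> \<open>The total coefficient at \<open>j\<close> after summing over \<open>k\<close>:
    the factor \<open>1 - q powi (s * k)\<close> yields one kernel at \<open>j\<close> and one at
    \<open>j + s\<close>.\<close>
  define f where "f j = c j * (bailey_kernel n j - bailey_kernel n (j + s))" for j
  define w where "w i = qpoch_fin q q i * qpoch_fin q q (2 * n - i)" for i
  have "((\<lambda>j. \<Sum>i\<le>2 * n. tau q (int i - int n) * (1 - q powi (s * (int i - int n))) / w i *
      (c j * q powi ((int i - int n) * j))) has_sum
      (\<Sum>i\<le>2 * n. tau q (int i - int n) * (1 - q powi (s * (int i - int n))) / w i * A (int i - int n))) UNIV"
    by (intro has_sum_sum has_sum_cmult_right A)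
  moreover have "(\<Sum>i\<le>2 * n. tau q (int i - int n) * (1 - q powi (s * (int i - int n))) / w i *
      (c j * q powi ((int i - int n) * j))) = f j" for j
  proof -
    have *: "q powi (k * (j + s)) = q powi (s * k) * q powi (k * j)" for k
      unfolding powi_add[symmetric] by (simp add: algebra_simps)
    have "tau q k * (1 - q powi (s * k)) / x * (c j * q powi (k * j)) =
        c j * (tau q k * q powi (k * j) / x - tau q k * q powi (k * (j + s)) / x)" for k x
      unfolding * by (simp add: diff_divide_distrib left_diff_distrib right_diff_distrib mult_ac)
    then show ?thesis
      unfolding f_def bailey_kernel_def w_def[symmetric] sum_subtractf[symmetric] sum_distrib_left
      by simp
  qed
  ultimately have "(f has_sum (\<Sum>i\<le>2 * n. \<alpha> (int i - int n) / w i)) UNIV"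
    by (simp add: \<alpha>_def)
  moreover have "(f has_sum 2 * S) UNIV"
  \<comment> \<open>Both kernels vanish for \<open>- n < j < n + 1 - s\<close>, so the right tail
    starts at \<open>n + 1 - s\<close> and the left one ends at \<open>- n\<close>.\<close>
  proof (rule has_sum_symmetric_halves[where m = "int n + 1 - s" and l = "1 - s"])
    show "((\<lambda>r. f (int n + 1 - s + int r)) has_sum S) UNIV"
      using S by (simp add: f_def algebra_simps)
    show "f (1 - s - j) = f j" for j
    proof -
      have "bailey_kernel n (1 - s - j) = bailey_kernel n (j + s)"
        using bailey_kernel_reflect[of n "j + s"] by (simp add: algebra_simps)
      moreover have "bailey_kernel n (1 - s - j + s) = bailey_kernel n j"
        using bailey_kernel_reflect[of n j] by simp
      ultimately show ?thesis
        by (simp only: f_def c) (simp add: algebra_simps)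
    qed
    show "f j = 0" if "1 - s - (int n + 1 - s) < j" "j < int n + 1 - s" for j
      using that s by (simp add: f_def bailey_kernel_eq_0)
  qed (use s in simp)
  ultimately have "(\<Sum>i\<le>2 * n. \<alpha> (int i - int n) / w i) = 2 * S"
    by (rule has_sum_unique)
  then have "2 * (\<Sum>k=0..n. \<alpha> (int k) / (qpoch_fin q q (n - k) * qpoch_fin q q (n + k))) = 2 * S"
    unfolding w_def by (subst (asm) sum_fold_even[where \<alpha> = \<alpha>, OF even]) (simp_all add: \<alpha>_def)
  then show ?thesis
    by (simp add: \<alpha>_def A_def)
qed

section \<open>Evaluation of the remaining tails\<close>

text \<open>Trades the quadratic power \<open>q powi (n * n)\<close> for \<open>tau\<close>, so that
  the kernels become rational in \<open>q ^ n\<close>, \<open>q ^ r\<close>,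
  \<open>q ^ (n * r)\<close> and \<open>tau q n\<close>.\<close>

lemma powi_neg_mult: "q powi (- (int n * (int n + k))) = q powi (- int n * k) / (tau q (int n) ^ 2 * q ^ n)"
proof -
  have "tau q (int n) ^ 2 * q ^ n = q powi (int n * int n)"
    using tau_power2[of "int n"] by simp
  moreover have "q powi (- (int n * (int n + k))) * q powi (int n * int n) = q powi (- int n * k)"
    by (simp add: algebra_simps flip: powi_add)
  ultimately show ?thesis
    by (simp add: eq_divide_eq)
qed

lemma powi_neg_mult_Suc: "q powi (- int n * (1 + int r)) = 1 / (q ^ (n * r) * q ^ n)"
proof -
  have "- int n * (1 + int r) = - int (n * r + n)"
    by (simp add: algebra_simps)
  then show ?thesis
    by (simp only: power_int_minus power_int_of_nat power_add divide_inverse mult_1_left)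
qed

lemma tau_cubed_add:
  "tau q (int n + int r) ^ 3 = tau q (int n) ^ 3 * tau q (int r) ^ 3 * (q ^ (n * r)) ^ 3"
  by (simp add: tau_add power_mult_distrib flip: of_nat_mult)

text \<open>The coefficients of \<open>H\<close> are thus negated cubes of \<open>tau\<close> at
  shifted arguments, which makes their antisymmetry visible.\<close>

lemma tau_cubed_shift: "tau q k ^ 3 * q powi (3 * k) = - (tau q (k + 1) ^ 3)"
  by (simp add: tau_Suc power_mult_distrib power_int_power' mult.commute[of 3])

text \<open>The kernels share \<open>qpoch_fin (q ^ Suc r) q (2 * n - 1)\<close>. Their difference
  leaves a multiple of \<open>1 + q ^ (n + r)\<close>, which with \<open>1 - q ^ (n + r)\<close>
  from the coefficient forms the factor of Sylvester's series at
  \<open>a = q ^ (2 * n)\<close>.\<close>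

lemma has_sum_kernel_diff_1:
  assumes n: "0 < n"
  shows "((\<lambda>r. tau q (int n + int r) ^ 3 * (1 - q powi (int n + int r)) * q powi (int n + int r) *
           (bailey_kernel n (int n + int r) - bailey_kernel n (int n + 1 + int r)))
         has_sum tau q (int n) ^ 2 * (q ^ n - 1) / qpoch_fin q q (2 * n) * qpoch_inf q q) UNIV"
proof -
  obtain p where p: "2 * n = Suc p"
    using n by (cases "2 * n") auto
  have "tau q (int n + int r) ^ 3 * (1 - q powi (int n + int r)) * q powi (int n + int r) *
           (bailey_kernel n (int n + int r) - bailey_kernel n (int n + 1 + int r)) =
        tau q (int n) ^ 2 * (q ^ n - 1) / qpoch_fin q q (2 * n) *
        (tau q (int r) ^ 3 * q ^ ((p + 2) * r) * (1 - q ^ (p + 1 + 2 * r)) * qpoch_fin (q ^ Suc r) q p)" for r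
  proof -
    define N R X E where defs: "N = q ^ n" "R = q ^ r" "X = q ^ (n * r)" "E = qpoch_fin (q ^ Suc r) q p"
    have nz: "N \<noteq> 0" "X \<noteq> 0" "tau q (int n) \<noteq> 0"
      by (simp_all add: defs)
    have j: "q powi (int n + int r) = N * R"
      by (simp add: powi_add defs)
    have "q ^ p * q = N * N"
      by (simp add: defs p flip: power_Suc2 power_add mult_2)
    then have "q ^ Suc r * q ^ p = R * N * N"
      by (simp add: defs mult_ac)
    then have E1: "qpoch_fin (q ^ Suc r) q (2 * n) = E * (1 - R * N * N)"
      unfolding p qpoch_fin_Suc by (simp only: defs)
    have E2: "qpoch_fin (q ^ r) q (2 * n) = (1 - R) * E"
      unfolding p qpoch_fin_Suc_left by (simp add: defs mult.commute)
    have K1: "bailey_kernel n (int n + int r) =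
        tau q (int n) * N * (1 / (X * (tau q (int n) ^ 2 * N))) * ((1 - R) * E) / qpoch_fin q q (2 * n)"
      unfolding bailey_kernel_eq powi_neg_mult
      by (simp add: E2 tau_uminus defs power_int_minus divide_simps flip: of_nat_mult)
    have "q powi (- int n * (1 + int r)) = 1 / (X * N)"
      by (simp only: defs powi_neg_mult_Suc)
    then have K2: "bailey_kernel n (int n + 1 + int r) =
        tau q (int n) * N * (1 / (X * N * (tau q (int n) ^ 2 * N))) * (E * (1 - R * N * N)) / qpoch_fin q q (2 * n)"
      unfolding bailey_kernel_eq add.assoc powi_neg_mult
      using E1 by (simp add: tau_uminus defs powi_add divide_simps)
    have "q ^ ((p + 2) * r) = X ^ 2 * R"
    proof -
      have "(p + 2) * r = (2 * n) * r + r"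
        unfolding p by simp
      then have "(p + 2) * r = n * r * 2 + r"
        by simp
      then show ?thesis
        by (simp only: defs power_add power_mult)
    qed
    moreover have "q ^ (p + 1 + 2 * r) = N * N * R * R"
      using p by (simp add: defs flip: power_add p) (simp add: mult_2 add.assoc)
    ultimately show ?thesis
      unfolding K1 K2 j tau_cubed_add defs(1,3,4)[symmetric]
      using nz by (simp add: divide_simps power2_eq_square power3_eq_cube) (simp add: algebra_simps)
  qed
  then show ?thesis
    by (simp only:) (intro has_sum_cmult_right sylvester_has_sum)
qed

text \<open>Now the kernel arguments differ by two and the common product has
  \<open>2 * n - 2\<close> factors. The remaining factors combine to a multiple of
  \<open>(1 - q ^ (2 * n)) * (1 - q ^ (2 * n + 2 * r - 1))\<close>, as in Sylvester's series at
  \<open>a = q ^ (2 * n - 1)\<close>.\<close>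

lemma has_sum_kernel_diff_2:
  assumes n: "0 < n"
  shows "((\<lambda>r. tau q (int n - 1 + int r) ^ 3 * q powi (3 * (int n - 1 + int r)) *
           (bailey_kernel n (int n - 1 + int r) - bailey_kernel n (int n + 1 + int r)))
         has_sum tau q (int n) ^ 2 * q powi (- int n) * (1 - q ^ (2 * n)) / qpoch_fin q q (2 * n) *
           qpoch_inf q q) UNIV"
proof -
  obtain p where p: "2 * n = Suc (Suc p)"
    using n by (cases n) auto
  have "tau q (int n - 1 + int r) ^ 3 * q powi (3 * (int n - 1 + int r)) *
           (bailey_kernel n (int n - 1 + int r) - bailey_kernel n (int n + 1 + int r)) =
        tau q (int n) ^ 2 * q powi (- int n) * (1 - q ^ (2 * n)) / qpoch_fin q q (2 * n) *
        (tau q (int r) ^ 3 * q ^ ((p + 2) * r) * (1 - q ^ (p + 1 + 2 * r)) * qpoch_fin (q ^ Suc r) q p)" for r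
  proof -
    define N R X E where defs: "N = q ^ n" "R = q ^ r" "X = q ^ (n * r)" "E = qpoch_fin (q ^ Suc r) q p"
    have nz: "N \<noteq> 0" "X \<noteq> 0" "tau q (int n) \<noteq> 0"
      by (simp_all add: defs)
    have c: "tau q (int n - 1 + int r) ^ 3 * q powi (3 * (int n - 1 + int r)) =
        - (tau q (int n) ^ 3 * tau q (int r) ^ 3 * X ^ 3)"
      using tau_cubed_add[of n r] unfolding tau_cubed_shift by (simp add: defs algebra_simps)
    have NN: "q ^ p * q * q = N * N"
      by (simp only: defs p flip: power_Suc2 power_add mult_2)
    then have "q ^ Suc r * q ^ p = R * N * N / q" "q ^ Suc r * q ^ Suc p = R * N * N"
      by (simp_all add: defs mult_ac eq_divide_eq)
    then have E1: "qpoch_fin (q ^ Suc r) q (2 * n) = E * (1 - R * N * N / q) * (1 - R * N * N)"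
      unfolding p qpoch_fin_Suc by (simp only: defs)
    \<comment> \<open>The base is \<open>q powi (r - 1)\<close>, written as \<open>R / q\<close>
      because the exponent is negative at \<open>r = 0\<close>.\<close>
    have E2: "qpoch_fin (R / q) q (2 * n) = (1 - R / q) * ((1 - R) * E)"
      unfolding p qpoch_fin_Suc_left by (simp add: defs mult.commute)
    have "q powi (- int n * (int r - 1)) = N / X"
      by (simp add: defs power_int_minus power_int_diff right_diff_distrib divide_simps flip: of_nat_mult)
    moreover have "q powi (int r - 1) = R / q"
      by (simp add: defs power_int_diff)
    ultimately have K1: "bailey_kernel n (int n + (int r - 1)) =
        tau q (int n) * N * (N / X / (tau q (int n) ^ 2 * N)) * ((1 - R / q) * ((1 - R) * E)) / qpoch_fin q q (2 * n)"
      unfolding bailey_kernel_eq powi_neg_mult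
      using E2 by (simp add: tau_uminus defs)
    have "q powi (- int n * (1 + int r)) = 1 / (X * N)"
      by (simp only: defs powi_neg_mult_Suc)
    then have K2: "bailey_kernel n (int n + (1 + int r)) =
        tau q (int n) * N * (1 / (X * N) / (tau q (int n) ^ 2 * N)) *
        (E * (1 - R * N * N / q) * (1 - R * N * N)) / qpoch_fin q q (2 * n)"
      unfolding bailey_kernel_eq powi_neg_mult
      using E1 by (simp add: tau_uminus defs powi_add)
    have "q ^ ((p + 2) * r) = X ^ 2"
    proof -
      have "(p + 2) * r = n * r * 2"
        using p by (metis add_2_eq_Suc' mult.assoc mult.commute)
      then show ?thesis
        by (simp add: defs power_mult)
    qed
    moreover have "q ^ (p + 1 + 2 * r) = N * N * R * R / q"
    proof -
      have "q ^ (p + 1 + 2 * r) = (q ^ p * q * q) * R * R / q"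
        by (simp add: defs power_add mult_2)
      then show ?thesis by (simp only: NN)
    qed
    moreover have "q ^ (2 * n) = N * N"
      by (simp add: defs mult_2 power_add)
    moreover have "q powi (- int n) = 1 / N"
      by (simp add: defs power_int_minus divide_inverse)
    moreover have "int n - 1 + int r = int n + (int r - 1)" "int n + 1 + int r = int n + (1 + int r)"
      by simp_all
    ultimately show ?thesis
      unfolding c defs(4)[symmetric]
      using nz K1 K2
      by (simp only:) (simp add: divide_simps power2_eq_square power3_eq_cube, simp add: algebra_simps)
  qed
  then show ?thesis
    by (simp only:) (intro has_sum_cmult_right sylvester_has_sum)
qed

end

section \<open>Assembly of the two Bailey pairs relative to \<open>1\<close>\<close>

theorem theorem6:
  fixes q :: complex
  assumes "0 < norm q" and "norm q < 1"
  shows "bailey_pair 1 q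
           (\<lambda>n. tau q (int n) * (1 - q ^ n) * G q (int n))
           (\<lambda>n. qpoch_inf q q * ((q ^ n - 1) * tau q (int n) ^ 2 / qpoch q q (2 * int n)))
       \<and> bailey_pair 1 q
           (\<lambda>n. tau q (int n) * (1 - q ^ (2 * n)) * H q (int n))
           (\<lambda>n. qpoch_inf q q * (tau q (int n) ^ 2 * q powi (- int n) / qpoch q q (2 * int n - 1)))"
proof -
  interpret nome q
    using assms by unfold_locales
  have denom: "qpoch q q (int n - int k) * qpoch q q (int n + int k) =
      qpoch_fin q q (n - k) * qpoch_fin q q (n + k)" if "k \<le> n" for n k
    using qpoch_eq_fin[of "n - k"] qpoch_eq_fin[of "n + k"] that by simp
  show ?thesis
    unfolding bailey_pair_def
  proof (intro conjI allI)
    fix n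
    let ?c = "\<lambda>j. tau q j ^ 3 * (1 - q powi j) * q powi j"
    show "qpoch_inf q q * ((q ^ n - 1) * tau q (int n) ^ 2 / qpoch q q (2 * int n)) =
      (\<Sum>k=0..n. tau q (int k) * (1 - q ^ k) * G q (int k) /
        (qpoch q q (int n - int k) * qpoch (1 * q) q (int n + int k)))"
    \<comment> \<open>The case \<open>n = 0\<close> lies outside \<open>bailey_sum\<close>, which
      asks for \<open>s \<le> 2 * n\<close>; there both sides are 0 through
      \<open>1 - q ^ 0\<close>.\<close>
    proof (cases "n = 0")
      case False
      have G: "G q k = (\<Sum>\<^sub>\<infinity>j. ?c j * q powi (k * j))" for k
        unfolding G_def by (simp add: ring_distribs powi_add mult.assoc)
      have "(\<Sum>k=0..n. tau q (int k) * (1 - q powi (1 * int k)) * (\<Sum>\<^sub>\<infinity>j. ?c j * q powi (int k * j))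
           / (qpoch_fin q q (n - k) * qpoch_fin q q (n + k))) =
           tau q (int n) ^ 2 * (q ^ n - 1) / qpoch_fin q q (2 * n) * qpoch_inf q q"
      proof (rule bailey_sum)
        show "?c (1 - 1 - j) = - ?c j" for j
          by (simp add: tau_uminus power_int_minus field_simps power3_eq_cube)
        show "(\<lambda>j. ?c j * q powi (k * j)) summable_on UNIV" for k
          using summable_on_add[OF summable_tau_cubed[of "1 + k"]
              summable_on_uminus[THEN iffD2, OF summable_tau_cubed[of "2 + k"]]]
          by (simp add: ring_distribs powi_add mult.commute[of 2] power_int_mult power2_eq_square mult_ac)
      qed (use False has_sum_kernel_diff_1[of n] in simp_all)
      then show ?thesis
        using qpoch_eq_fin[of "2 * n"] by (simp add: G denom)
    qed (simp add: denom)
  next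
    fix n
    let ?c = "\<lambda>j. tau q j ^ 3 * q powi (3 * j)"
    show "qpoch_inf q q * (tau q (int n) ^ 2 * q powi (- int n) / qpoch q q (2 * int n - 1)) =
      (\<Sum>k=0..n. tau q (int k) * (1 - q ^ (2 * k)) * H q (int k) /
        (qpoch q q (int n - int k) * qpoch (1 * q) q (int n + int k)))"
    proof (cases "n = 0")
      case True
      then show ?thesis by (simp add: qpoch_minus_1)
    next
      case False
      have H: "H q k = (\<Sum>\<^sub>\<infinity>j. ?c j * q powi (k * j))" for k
        unfolding H_def by (simp add: ring_distribs powi_add mult.assoc)
      have "(\<Sum>k=0..n. tau q (int k) * (1 - q powi (2 * int k)) * (\<Sum>\<^sub>\<infinity>j. ?c j * q powi (int k * j))
           / (qpoch_fin q q (n - k) * qpoch_fin q q (n + k))) =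
           tau q (int n) ^ 2 * q powi (- int n) * (1 - q ^ (2 * n)) / qpoch_fin q q (2 * n) * qpoch_inf q q"
      proof (rule bailey_sum)
        show "?c (1 - 2 - j) = - ?c j" for j
          using tau_uminus[of j] tau_Suc[of j]
          unfolding tau_cubed_shift by (simp add: power3_eq_cube)
        show "(\<lambda>j. ?c j * q powi (k * j)) summable_on UNIV" for k
          using summable_tau_cubed[of "3 + k"] by (simp add: ring_distribs powi_add mult.assoc)
      qed (use False has_sum_kernel_diff_2[of n] in simp_all)
      \<comment> \<open>The factor \<open>1 - q ^ (2 * n)\<close> in the numerator lowers the
        denominator index from \<open>2 * n\<close> to \<open>2 * n - 1\<close>.\<close>
      moreover have "qpoch_fin q q (2 * n) = qpoch q q (2 * int n - 1) * (1 - q ^ (2 * n))"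
      proof -
        obtain p where p: "2 * n = Suc p"
          using False by (cases "2 * n") auto
        then have "2 * int n - 1 = int p" by linarith
        then show ?thesis
          by (simp add: p qpoch_eq_fin qpoch_fin_Suc)
      qed
      moreover have powi_double: "q powi (2 * int k) = q ^ (2 * k)" for k
        by (metis of_nat_mult of_nat_numeral power_int_of_nat)
      moreover have "1 - q ^ (2 * n) \<noteq> 0"
        using False q_power_Suc_neq_1[of "2 * n - 1"] by (simp flip: power_Suc)
      ultimately show ?thesis
        by (simp add: H denom powi_double)
    qed
  qed
qed

end
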